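(* Let $k\ge 0$ be an integer and let $G$ be a circle $k$-visibility graph or an arc $k$-visibility graph with $n$ vertices. If $n>4k+4$, then $G$ has at most $(k+1)(3n-k-2)$ edges; if $n\le 4k+4$, then $G$ has at most $\binom{n}{2}$ edges.
   Context: All circles and arcs are centered at the origin of the plane. An arc is a set given in polar coordinates by $\{(r,\alpha):\alpha_1\le\alpha\le\alpha_2\}$ with $r>0$, $\alpha_1\in[0,2\pi)$ and $0\le\alpha_2-\alpha_1<2\pi$. A (non-degenerate) cone is a 4-sided region of positive area with two opposite sides being arcs of circles centered at the origin and the other two sides being (possibly intersecting) radial line segments. So a cone is either a region $\{(r,\alpha): r_1\le r\le r_2,\ \theta_1\le\alpha\le\theta_2\}$ or a "bow-tie" region through the origin, $\{(r,\alpha):0\le r\le r_1,\ \theta_1\le\alpha\le\theta_2\}\cup\{(r,\alpha):0\le r\le r_2,\ \theta_1+\pi\le\alpha\le\theta_2+\pi\}$; in particular, visibility through the origin is allowed. The two circular sides are called the circular ends of the cone. An arc $k$-visibility graph is a graph whose vertices can be represented by pairwise disjoint arcs such that two distinct vertices are adjacent if and only if there is a cone whose two circular ends are subsets of the two corresponding arcs, one in each, and which intersects at most $k$ arcs of the representation other than these two. A circle $k$-visibility graph is defined in the same way, except that each vertex may be represented either by an arc or by a full circle centered at the origin (the objects still being pairwise disjoint). *)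

theory Defs
  imports "HOL-Analysis.Analysis"
begin

definition simple_graph :: "'v set \<Rightarrow> 'v set set \<Rightarrow> bool" where
  "simple_graph V E \<longleftrightarrow> finite V \<and> E \<subseteq> {e. e \<subseteq> V \<and> card e = 2}"

text \<open>The plane is identified with the complex numbers; \<open>rcis r t\<close> is the point with
  polar coordinates \<open>(r, t)\<close>.\<close>

definition polar_arc :: "real \<Rightarrow> real \<Rightarrow> real \<Rightarrow> complex set" where
  "polar_arc r a b = {rcis r t | t. a \<le> t \<and> t \<le> b}"

definition polar_region :: "real \<Rightarrow> real \<Rightarrow> real \<Rightarrow> real \<Rightarrow> complex set" where
  "polar_region s r a b = {rcis \<rho> t | \<rho> t. s \<le> \<rho> \<and> \<rho> \<le> r \<and> a \<le> t \<and> t \<le> b}"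

text \<open>An arc may degenerate to a single point, but it is never a full circle.\<close>

definition is_arc :: "complex set \<Rightarrow> bool" where
  "is_arc S \<longleftrightarrow> (\<exists>r a b. 0 < r \<and> 0 \<le> a \<and> a < 2 * pi \<and> 0 \<le> b - a \<and> b - a < 2 * pi
     \<and> S = polar_arc r a b)"

definition is_circle :: "complex set \<Rightarrow> bool" where
  "is_circle S \<longleftrightarrow> (\<exists>r>0. S = sphere 0 r)"

text \<open>\<open>cone C A B\<close>: the region \<open>C\<close> is a non-degenerate cone with circular ends \<open>A\<close> and \<open>B\<close>.
  The strict inequalities express positive area. The upper bounds on the angular width say that
  the region is four-sided: an annular region must not close up to an annulus, and the two
  halves of a bow-tie must meet in the origin only. They do not affect visibility, as a cone with
  a narrower range of angles is contained in the wider one, and so are its ends.\<close>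

inductive cone :: "complex set \<Rightarrow> complex set \<Rightarrow> complex set \<Rightarrow> bool" where
  radial: "0 < r1 \<Longrightarrow> r1 < r2 \<Longrightarrow> \<theta>1 < \<theta>2 \<Longrightarrow> \<theta>2 - \<theta>1 < 2 * pi \<Longrightarrow>
     cone (polar_region r1 r2 \<theta>1 \<theta>2) (polar_arc r1 \<theta>1 \<theta>2) (polar_arc r2 \<theta>1 \<theta>2)"
| bow_tie: "0 < r1 \<Longrightarrow> 0 < r2 \<Longrightarrow> \<theta>1 < \<theta>2 \<Longrightarrow> \<theta>2 - \<theta>1 < pi \<Longrightarrow>
     cone (polar_region 0 r1 \<theta>1 \<theta>2 \<union> polar_region 0 r2 (\<theta>1 + pi) (\<theta>2 + pi))
       (polar_arc r1 \<theta>1 \<theta>2) (polar_arc r2 (\<theta>1 + pi) (\<theta>2 + pi))"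

text \<open>In a family \<open>f\<close> of objects indexed by \<open>V\<close>, the objects of \<open>u\<close> and \<open>v\<close> see each other
  through at most \<open>k\<close> of the others.\<close>

definition k_visible :: "nat \<Rightarrow> 'v set \<Rightarrow> ('v \<Rightarrow> complex set) \<Rightarrow> 'v \<Rightarrow> 'v \<Rightarrow> bool" where
  "k_visible k V f u v \<longleftrightarrow> (\<exists>C A B. cone C A B
     \<and> (A \<subseteq> f u \<and> B \<subseteq> f v \<or> A \<subseteq> f v \<and> B \<subseteq> f u)
     \<and> card {w \<in> V - {u, v}. C \<inter> f w \<noteq> {}} \<le> k)"

definition k_visibility_representation ::
  "nat \<Rightarrow> 'v set \<Rightarrow> 'v set set \<Rightarrow> ('v \<Rightarrow> complex set) \<Rightarrow> bool" where
  "k_visibility_representation k V E f \<longleftrightarrow> disjoint_family_on f V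
     \<and> (\<forall>u\<in>V. \<forall>v\<in>V. u \<noteq> v \<longrightarrow> ({u, v} \<in> E \<longleftrightarrow> k_visible k V f u v))"

definition arc_k_visibility_graph :: "nat \<Rightarrow> 'v set \<Rightarrow> 'v set set \<Rightarrow> bool" where
  "arc_k_visibility_graph k V E \<longleftrightarrow> simple_graph V E
     \<and> (\<exists>f. (\<forall>v\<in>V. is_arc (f v)) \<and> k_visibility_representation k V E f)"

definition circle_k_visibility_graph :: "nat \<Rightarrow> 'v set \<Rightarrow> 'v set set \<Rightarrow> bool" where
  "circle_k_visibility_graph k V E \<longleftrightarrow> simple_graph V E
     \<and> (\<exists>f. (\<forall>v\<in>V. is_arc (f v) \<or> is_circle (f v)) \<and> k_visibility_representation k V E f)"

end

theory Submission imports Defs begin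

text \<open>A line through the origin is rotated once around; the objects that it meets form a word,
  listed by signed radius. Two objects of an edge see each other on some line, and the sighting is
  based at the one with the larger radius. Unless it persists for all angles, it appears at some
  moment: either one of the two objects starts, or an object between them ends. At the start of an
  object at most \<open>k + 1\<close> sightings lead inwards and \<open>k + 1\<close> outwards, and at its end at most
  \<open>k + 1\<close> pairs straddle it; sightings that persist are charged to the inward ones. The \<open>i\<close>-th
  object from outside has at most \<open>i - 1\<close> objects beyond it, so the outward and the straddling
  ones are in fact bounded by \<open>min (k + 1) (i - 1)\<close>. Summing \<open>(k + 1) + 2 min (k + 1) (i - 1)\<close> over \<open>i\<close> gives the
  bound. A full circle is treated as the closed arc from \<open>0\<close> to \<open>2 pi\<close>, which never starts or
  ends.\<close>

section \<open>Sightings and straddling pairs on a single line\<close>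

text \<open>An object may lie on the line twice, once on each side of the origin. Objects and not
  positions are collected, so that each blocker counts once.\<close>

definition inside :: "(real \<times> 'v) set \<Rightarrow> real \<Rightarrow> real \<Rightarrow> 'v set" where
  "inside K p q = {v. \<exists>x. (x, v) \<in> K \<and> min p q < x \<and> x < max p q}"

definition sees :: "nat \<Rightarrow> (real \<times> 'v) set \<Rightarrow> real \<Rightarrow> 'v \<Rightarrow> real \<Rightarrow> 'v \<Rightarrow> bool" where
  "sees k K p u q v \<longleftrightarrow> (p, u) \<in> K \<and> (q, v) \<in> K \<and> u \<notin> inside K p q \<and> v \<notin> inside K p q
     \<and> card (inside K p q) \<le> k"

definition mirror :: "(real \<times> 'v) set \<Rightarrow> (real \<times> 'v) set" where
  "mirror K = {(x, v). (- x, v) \<in> K}"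

lemma inside_commute: "inside K p q = inside K q p"
  by (simp add: inside_def min.commute max.commute)

lemma sees_commute: "sees k K p u q v \<longleftrightarrow> sees k K q v p u"
  by (auto simp: sees_def inside_commute)

lemma inside_mirror: "inside (mirror K) p q = inside K (- p) (- q)"
proof -
  have *: "min p q < x \<and> x < max p q \<longleftrightarrow> min (- p) (- q) < - x \<and> - x < max (- p) (- q)" for x
    by (auto simp: min_def max_def)
  show ?thesis
    unfolding inside_def mirror_def
    by (auto simp: *) (metis add.inverse_inverse)
qed

lemma sees_mirror: "sees k (mirror K) p u q v \<longleftrightarrow> sees k K (- p) u (- q) v"
  by (simp add: sees_def inside_mirror) (simp add: mirror_def)

lemma finite_inside: "finite K \<Longrightarrow> finite (inside K p q)"
  by (rule finite_subset[of _ "snd ` K"]) (force simp: inside_def)+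

lemma inside_mono: "K \<subseteq> K' \<Longrightarrow> inside K p q \<subseteq> inside K' p q"
  by (auto simp: inside_def)

lemma single_valued_mirror: "single_valued K \<Longrightarrow> single_valued (mirror K)"
  by (auto simp: single_valued_def mirror_def)

lemma finite_mirror: "finite K \<Longrightarrow> finite (mirror K)"
  by (rule finite_subset[of _ "(\<lambda>(x, v). (- x, v)) ` K"]) (force simp: mirror_def)+

text \<open>The lowest object seen from \<open>p\<close> has all the other seen ones between itself
  and \<open>p\<close>, as distinct objects have distinct positions. At most \<open>k\<close> fit
  there.\<close>

lemma card_seen_below:
  assumes K: "finite K" "single_valued K"
  shows "card {v. \<exists>q<p. sees k K p u q v} \<le> k + 1"
proof -
  define X where "X = {v. \<exists>q<p. sees k K p u q v}"
  have "finite X"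
    by (rule finite_subset[of _ "snd ` K"]) (force simp: X_def sees_def K)+
  have "\<forall>v\<in>X. \<exists>q. q < p \<and> sees k K p u q v"
    by (auto simp: X_def)
  then obtain q where q: "\<And>v. v \<in> X \<Longrightarrow> q v < p" "\<And>v. v \<in> X \<Longrightarrow> sees k K p u (q v) v"
    by metis
  show ?thesis
  proof (cases "X = {}")
    case False
    with \<open>finite X\<close> obtain v where v: "v \<in> X" "\<And>w. w \<in> X \<Longrightarrow> q v \<le> q w"
      by (metis arg_min_if_finite(1) arg_min_least)
    have "X - {v} \<subseteq> inside K p (q v)"
    proof
      fix w assume w: "w \<in> X - {v}"
      then have "(q w, w) \<in> K" "(q v, v) \<in> K" "q v \<le> q w" "q w < p"
        using q v by (auto simp: sees_def)
      moreover from this have "q v \<noteq> q w"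
        using w K(2) by (metis DiffD2 insertI1 single_valuedD)
      ultimately show "w \<in> inside K p (q v)"
        by (auto simp: inside_def intro!: exI[of _ "q w"])
    qed
    then have "card (X - {v}) \<le> card (inside K p (q v))"
      using K by (intro card_mono finite_inside)
    also have "\<dots> \<le> k"
      using q(2)[OF v(1)] by (simp add: sees_def)
    finally show ?thesis
      using v(1) \<open>finite X\<close> by (simp add: X_def[symmetric])
  qed (simp add: X_def[symmetric])
qed

lemma card_seen_above:
  assumes "finite K" "single_valued K"
  shows "card {v. \<exists>q>p. sees k K p u q v} \<le> k + 1"
proof -
  have "{v. \<exists>q>p. sees k K p u q v} = {v. \<exists>q< -p. sees k (mirror K) (- p) u q v}"
    by (auto simp: sees_mirror) (metis add.inverse_inverse neg_less_iff_less minus_less_iff)+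
  then show ?thesis
    using card_seen_below[of "mirror K"] assms
    by (simp add: finite_mirror single_valued_mirror)
qed

text \<open>These pairs just fail to see each other across position \<open>z\<close>. The exact
  count \<open>k + 1\<close> makes the partner of \<open>u\<close> unique.\<close>

definition straddling :: "nat \<Rightarrow> (real \<times> 'v) set \<Rightarrow> real \<Rightarrow> real \<Rightarrow> 'v \<Rightarrow> real \<Rightarrow> 'v \<Rightarrow> bool" where
  "straddling k K z p u q v \<longleftrightarrow> q < z \<and> z < p \<and> (p, u) \<in> K \<and> (q, v) \<in> K
     \<and> u \<notin> inside K p q \<and> v \<notin> inside K p q \<and> card (inside K p q) = k + 1"

text \<open>A lower occurrence of \<open>u\<close> would lie inside the interval of a higher one,
  which is excluded. With \<open>p\<close> fixed, a more distant partner has strictly more objects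
  in between, so both counts cannot be \<open>k + 1\<close>.\<close>

lemma straddling_unique:
  assumes K: "finite K"
    and s: "straddling k K z p u q v" "straddling k K z p' u q' v'" and sv: "single_valued K"
  shows "p = p'" "v = v'"
proof -
  have no: False if "straddling k K z p u q v" "straddling k K z p' u q' v'" "p < p'" for p q v p' q' v'
  proof -
    have "u \<in> inside K p' q'"
      using that by (auto simp: straddling_def inside_def intro!: exI[of _ p])
    then show False
      using that by (simp add: straddling_def)
  qed
  show pp: "p = p'"
    using no[OF s] no[OF s(2,1)] by (cases p p' rule: linorder_cases) auto
  have no2: False if "straddling k K z p u q v" "straddling k K z p u q' v'" "q' < q" for q v q' v'
  proof -
    have "inside K p q \<subseteq> inside K p q'"
      using that by (auto simp: inside_def straddling_def)
    moreover have "v \<in> inside K p q'" "v \<notin> inside K p q"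
      using that by (auto simp: inside_def straddling_def intro!: exI[of _ q])
    ultimately have "inside K p q \<subset> inside K p q'"
      by blast
    then have "card (inside K p q) < card (inside K p q')"
      by (simp add: psubset_card_mono finite_inside K)
    then show False
      using that by (simp add: straddling_def)
  qed
  have "q = q'"
    using no2[OF s(1)] no2[of q' v' q v] s pp by (metis linorder_neqE_linordered_idom)
  then show "v = v'"
    using s sv by (auto simp: straddling_def dest: single_valuedD)
qed

text \<open>The upper end determines the pair, so it suffices to count upper ends. The highest one
  has all the others between its ends and also \<open>c\<close>, which leaves room for at most
  \<open>k\<close> others.\<close>

lemma card_straddling:
  assumes K: "finite K" "single_valued K" and z: "(z, c) \<in> K"
    and A: "finite A" "\<And>x v. (x, v) \<in> K \<Longrightarrow> z < x \<Longrightarrow> v \<in> A"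
  shows "card {{u, v} | u v. \<exists>p q. straddling k K z p u q v} \<le> min (k + 1) (card A)"
proof -
  define U where "U = {u. \<exists>p q v. straddling k K z p u q v}"
  have "U \<subseteq> A"
    using A(2) by (auto simp: U_def straddling_def)
  then have "finite U"
    using A(1) finite_subset by blast
  have "\<forall>u\<in>U. \<exists>p q v. straddling k K z p u q v"
    by (auto simp: U_def)
  then obtain p q v where s: "\<And>u. u \<in> U \<Longrightarrow> straddling k K z (p u) u (q u) (v u)"
    by metis
  have "card U \<le> k + 1"
  proof (cases "U = {}")
    case False
    with \<open>finite U\<close> obtain u where u: "u \<in> U" "\<And>w. w \<in> U \<Longrightarrow> p w \<le> p u"
      using ex_min_if_finite[of "(\<lambda>w. - p w) ` U"] by (auto simp: not_less)
    have c: "c \<in> inside K (p w) (q w)" if "w \<in> U" for w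
      using s[OF that] z by (auto simp: straddling_def inside_def intro!: exI[of _ z])
    have "U - {u} \<subseteq> inside K (p u) (q u) - {c}"
    proof
      fix w assume w: "w \<in> U - {u}"
      then have "straddling k K z (p w) w (q w) (v w)" "straddling k K z (p u) u (q u) (v u)" "p w \<le> p u"
        using s u by auto
      moreover from this have "p w \<noteq> p u"
        using w K(2) by (metis DiffD2 insertI1 single_valuedD straddling_def)
      moreover have "w \<noteq> c"
        using c[of w] w calculation by (auto simp: straddling_def)
      ultimately show "w \<in> inside K (p u) (q u) - {c}"
        by (auto simp: inside_def straddling_def intro!: exI[of _ "p w"])
    qed
    then have "card (U - {u}) \<le> card (inside K (p u) (q u) - {c})"
      using K by (intro card_mono finite_Diff finite_inside)
    also have "\<dots> \<le> k"
      using s[OF u(1)] c[OF u(1)] by (simp add: straddling_def)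
    finally show ?thesis
      using u(1) \<open>finite U\<close> by simp
  qed simp
  moreover have "card U \<le> card A"
    using \<open>U \<subseteq> A\<close> A(1) by (simp add: card_mono)
  moreover have "{{u, v} | u v. \<exists>p q. straddling k K z p u q v} \<subseteq> (\<lambda>u. {u, v u}) ` U"
  proof clarify
    fix u w p' q' assume a: "straddling k K z p' u q' w"
    then have "u \<in> U" by (auto simp: U_def)
    moreover have "w = v u"
      using straddling_unique(2)[OF K(1) a s[OF \<open>u \<in> U\<close>] K(2)] .
    ultimately show "{u, w} \<in> (\<lambda>u. {u, v u}) ` U" by blast
  qed
  then have "card {{u, v} | u v. \<exists>p q. straddling k K z p u q v} \<le> card U"
    by (rule surj_card_le[OF \<open>finite U\<close>])
  ultimately show ?thesis
    by simp
qed

lemma sees_subset: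
  assumes "sees k K' p u q v" "K \<subseteq> K'" "(p, u) \<in> K" "(q, v) \<in> K" "finite K'"
  shows "sees k K p u q v"
  using assms inside_mono[OF assms(2), of p q] card_mono[OF finite_inside[OF assms(5)], of "inside K p q" p q]
  by (auto simp: sees_def)

text \<open>If \<open>x\<close> were not between \<open>p\<close> and \<open>q\<close>, the old
  sighting would survive; if \<open>c\<close> were \<open>v\<close>, a shorter one would end at
  \<open>x\<close>. So \<open>c\<close> is a third object, and it raises a count of at most
  \<open>k\<close> by at most one to a value above \<open>k\<close>.\<close>

lemma sees_insert_blocked:
  assumes s: "sees k K p u q v" and no: "\<And>q. \<not> sees k (insert (x, c) K) p u q v"
    and "c \<noteq> u" "finite K"
  shows "min p q < x" "x < max p q" "u \<notin> inside (insert (x, c) K) p q"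
    "v \<notin> inside (insert (x, c) K) p q" "card (inside (insert (x, c) K) p q) = k + 1"
proof -
  let ?K = "insert (x, c) K"
  have x: "min p q < x \<and> x < max p q"
  proof (rule ccontr)
    assume "\<not> ?thesis"
    then have "inside ?K p q = inside K p q"
      by (auto simp: inside_def)
    then show False
      using s no[of q] by (simp add: sees_def)
  qed
  then show "min p q < x" "x < max p q" by auto
  have b: "inside ?K p q = insert c (inside K p q)"
    using x by (auto simp: inside_def)
  have "c \<noteq> v"
  proof
    assume "c = v"
    have sub: "inside ?K p x \<subseteq> inside K p q"
    proof
      fix w assume "w \<in> inside ?K p x"
      then obtain y where y: "(y, w) \<in> ?K" "min p x < y" "y < max p x"
        by (auto simp: inside_def)
      then have "(y, w) \<in> K" by auto
      then show "w \<in> inside K p q"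
        using x y by (auto simp: inside_def min_def max_def split: if_splits intro!: exI[of _ y])
    qed
    then have "card (inside ?K p x) \<le> k"
      using s card_mono[OF finite_inside[OF \<open>finite K\<close>] sub] by (simp add: sees_def)
    then have "sees k ?K p u x v"
      using s sub \<open>c = v\<close> by (auto simp: sees_def)
    then show False using no by blast
  qed
  show "u \<notin> inside ?K p q" "v \<notin> inside ?K p q"
    using s \<open>c \<noteq> u\<close> \<open>c \<noteq> v\<close> by (auto simp: b sees_def)
  then have "\<not> card (inside ?K p q) \<le> k"
    using no[of q] s by (auto simp: sees_def)
  moreover have "card (inside ?K p q) \<le> card (inside K p q) + 1"
    unfolding b by (simp add: card_insert_if finite_inside \<open>finite K\<close>)
  ultimately show "card (inside ?K p q) = k + 1"
    using s by (simp add: sees_def)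
qed

section \<open>One-sided limits and angles modulo \<open>2 * pi\<close>\<close>

text \<open>\<open>Q\<close> is the left limit of \<open>P\<close>. Let \<open>s\<close> be the
  supremum of the failures of \<open>P\<close> up to \<open>t1\<close>: constancy to the right
  forces \<open>P s\<close>, hence failures accumulate at \<open>s\<close> from the left and refute
  \<open>Q s\<close>.\<close>

lemma exists_switch_on:
  fixes P Q :: "real \<Rightarrow> bool"
  assumes right: "\<And>t. \<forall>\<^sub>F s in at_right t. P s = P t"
    and left: "\<And>t. \<forall>\<^sub>F s in at_left t. P s = Q t"
    and "P t1" "\<not> P t0" "t0 < t1"
  shows "\<exists>t. P t \<and> \<not> Q t"
proof -
  define S where "S = {t. t \<le> t1 \<and> \<not> P t}"
  define s where "s = Sup S"
  have ne: "S \<noteq> {}" and bdd: "bdd_above S"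
    using assms by (auto simp: S_def bdd_above_def intro: less_imp_le)
  have "s \<le> t1"
    unfolding s_def using ne by (intro cSup_least) (auto simp: S_def)
  have upper: "P t" if "s < t" "t \<le> t1" for t
  proof (rule ccontr)
    assume "\<not> P t"
    then have "t \<le> s"
      unfolding s_def using that bdd by (intro cSup_upper) (auto simp: S_def)
    then show False using that by simp
  qed
  have "P s"
  proof (rule ccontr)
    assume "\<not> P s"
    then have "s < t1" using \<open>s \<le> t1\<close> \<open>P t1\<close> by (cases "s = t1") auto
    from right[of s] obtain d where d: "d > s" "\<And>t. s < t \<Longrightarrow> t < d \<Longrightarrow> P t = P s"
      by (auto simp: eventually_at_right_field)
    define t where "t = min t1 ((s + d) / 2)"
    have "s < t" "t < d" "t \<le> t1"
      using d(1) \<open>s < t1\<close> by (auto simp: t_def min_def field_simps)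
    then show False
      using d(2) upper \<open>\<not> P s\<close> by blast
  qed
  moreover have "\<not> Q s"
  proof
    assume "Q s"
    from left[of s] obtain d where d: "d < s" "\<And>t. d < t \<Longrightarrow> t < s \<Longrightarrow> P t = Q s"
      by (auto simp: eventually_at_left_field)
    obtain t where t: "t \<in> S" "d < t"
      using less_cSup_iff[OF ne bdd] d(1) by (auto simp: s_def)
    then have "t \<le> s" "\<not> P t"
      using bdd by (auto simp: s_def S_def intro!: cSup_upper)
    then show False
      using d(2)[of t] t \<open>Q s\<close> \<open>P s\<close> by (cases "t = s") auto
  qed
  ultimately show ?thesis by blast
qed

lemma period_representative:
  fixes a t :: real
  obtains n :: int where "a \<le> t + 2 * pi * n" "t + 2 * pi * n < a + 2 * pi"
proof
  let ?n = "\<lfloor>(t - a) / (2 * pi)\<rfloor>"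
  have "?n * (2 * pi) \<le> t - a" "t - a < (?n + 1) * (2 * pi)"
    by (simp_all add: floor_divide_lower floor_divide_upper)
  then show "a \<le> t + 2 * pi * (- ?n)" "t + 2 * pi * (- ?n) < a + 2 * pi"
    by (simp_all add: algebra_simps)
qed

lemma period_cases:
  fixes n :: int
  obtains "n = 0" | "2 * pi \<le> 2 * pi * n" | "2 * pi * n \<le> - (2 * pi)"
proof -
  consider "n = 0" | "real_of_int n \<ge> 1" | "real_of_int n \<le> - 1"
    by linarith
  then show thesis
  proof cases
    case 2
    from mult_left_mono[OF this, of "2 * pi"] show ?thesis using that by simp
  next
    case 3
    from mult_left_mono[OF this, of "2 * pi"] show ?thesis using that by simp
  qed (use that in simp)
qed

lemma polar_regionI:
  "\<lbrakk>s \<le> \<rho>; \<rho> \<le> r; a \<le> t; t \<le> b\<rbrakk> \<Longrightarrow> rcis \<rho> t \<in> polar_region s r a b"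
  unfolding polar_region_def by blast

section \<open>Arcs and the words on a rotating line\<close>

locale arcs =
  fixes V :: "'v set" and r a b :: "'v \<Rightarrow> real"
  assumes finite_V: "finite V"
    and r_pos: "v \<in> V \<Longrightarrow> 0 < r v"
    and ab: "v \<in> V \<Longrightarrow> a v \<le> b v" "v \<in> V \<Longrightarrow> b v \<le> a v + 2 * pi"
    and disjoint: "\<lbrakk>u \<in> V; v \<in> V; polar_arc (r u) (a u) (b u) \<inter> polar_arc (r v) (a v) (b v) \<noteq> {}\<rbrakk> \<Longrightarrow> u = v"
begin

definition covers :: "'v \<Rightarrow> real \<Rightarrow> bool" where
  "covers v t \<longleftrightarrow> (\<exists>n::int. a v \<le> t + 2 * pi * n \<and> t + 2 * pi * n \<le> b v)"

text \<open>\<open>covers_right v t\<close> and \<open>covers_left v t\<close>: the object covers the angles just after and just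
  before \<open>t\<close>. A one-point arc covers none.\<close>

definition covers_right :: "'v \<Rightarrow> real \<Rightarrow> bool" where
  "covers_right v t \<longleftrightarrow> (\<exists>n::int. a v \<le> t + 2 * pi * n \<and> t + 2 * pi * n < b v)"

definition covers_left :: "'v \<Rightarrow> real \<Rightarrow> bool" where
  "covers_left v t \<longleftrightarrow> (\<exists>n::int. a v < t + 2 * pi * n \<and> t + 2 * pi * n \<le> b v)"

lemma covers_right_imp: "covers_right v t \<Longrightarrow> covers v t"
  and covers_left_imp: "covers_left v t \<Longrightarrow> covers v t"
  by (auto simp: covers_def covers_right_def covers_left_def intro: less_imp_le)

lemma shift_int_iff:
  "(\<exists>n::int. P (t + 2 * pi * m + 2 * pi * n)) \<longleftrightarrow> (\<exists>n::int. P (t + 2 * pi * n))" for m :: int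
proof
  assume "\<exists>n::int. P (t + 2 * pi * m + 2 * pi * n)"
  then obtain n :: int where "P (t + 2 * pi * m + 2 * pi * n)" by blast
  then show "\<exists>n::int. P (t + 2 * pi * n)"
    by (intro exI[of _ "m + n"]) (simp add: algebra_simps)
next
  assume "\<exists>n::int. P (t + 2 * pi * n)"
  then obtain n :: int where "P (t + 2 * pi * n)" by blast
  then show "\<exists>n::int. P (t + 2 * pi * m + 2 * pi * n)"
    by (intro exI[of _ "n - m"]) (simp add: algebra_simps)
qed

lemma covers_periodic: "covers v (t + 2 * pi * m) = covers v t"
  and covers_right_periodic: "covers_right v (t + 2 * pi * m) = covers_right v t"
  and covers_left_periodic: "covers_left v (t + 2 * pi * m) = covers_left v t" for m :: int
  using shift_int_iff[of "\<lambda>x. a v \<le> x \<and> x \<le> b v" t m] shift_int_iff[of "\<lambda>x. a v \<le> x \<and> x < b v" t m]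
    shift_int_iff[of "\<lambda>x. a v < x \<and> x \<le> b v" t m]
  unfolding covers_def covers_right_def covers_left_def by auto

text \<open>Within one turn from \<open>a v\<close>, a shift by a nonzero number of turns leaves the
  arc, so only \<open>n = 0\<close> matters.\<close>

lemma covers_right_iff:
  assumes "v \<in> V" "a v \<le> t" "t < a v + 2 * pi"
  shows "covers_right v t \<longleftrightarrow> t < b v"
proof
  assume "covers_right v t"
  then obtain n :: int where "a v \<le> t + 2 * pi * n" "t + 2 * pi * n < b v"
    by (auto simp: covers_right_def)
  then show "t < b v"
    using assms ab[of v] by (cases n rule: period_cases) auto
qed (use assms in \<open>auto simp: covers_right_def intro!: exI[of _ 0]\<close>)

lemma covers_left_iff:
  assumes "v \<in> V" "a v < t" "t \<le> a v + 2 * pi"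
  shows "covers_left v t \<longleftrightarrow> t \<le> b v"
proof
  assume "covers_left v t"
  then obtain n :: int where "a v < t + 2 * pi * n" "t + 2 * pi * n \<le> b v"
    by (auto simp: covers_left_def)
  then show "t \<le> b v"
    using assms ab[of v] by (cases n rule: period_cases) auto
qed (use assms in \<open>auto simp: covers_left_def intro!: exI[of _ 0]\<close>)

lemma covers_iff:
  assumes "v \<in> V" "a v < t" "t < a v + 2 * pi"
  shows "covers v t \<longleftrightarrow> t \<le> b v"
proof
  assume "covers v t"
  then obtain n :: int where "a v \<le> t + 2 * pi * n" "t + 2 * pi * n \<le> b v"
    by (auto simp: covers_def)
  then show "t \<le> b v"
    using assms ab[of v] by (cases n rule: period_cases) auto
qed (use assms in \<open>auto simp: covers_def intro!: exI[of _ 0]\<close>)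

lemma right_germ:
  assumes v: "v \<in> V"
  shows "\<forall>\<^sub>F s in at_right t. covers_right v s = covers_right v t \<and> covers v s = covers_right v t"
proof -
  obtain n :: int where n: "a v \<le> t + 2 * pi * n" "t + 2 * pi * n < a v + 2 * pi"
    using period_representative by blast
  let ?t = "t + 2 * pi * n"
  \<comment> \<open>The next angle at which the status can change: the end of the arc if it covers
    the angles just after \<open>t\<close>, otherwise its start one turn later.\<close>
  define c where "c = t + (if ?t < b v then b v else a v + 2 * pi) - ?t"
  have "t < c" using n by (auto simp: c_def)
  moreover have "covers_right v s = covers_right v t \<and> covers v s = covers_right v t"
    if "t < s" "s < c" for s
  proof -
    let ?s = "s + 2 * pi * n"
    have 1: "a v < ?s" "?s < a v + 2 * pi"
      using n that ab[OF v] by (auto simp: c_def split: if_splits)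
    have "?t < b v \<longleftrightarrow> ?s < b v" "?t < b v \<longleftrightarrow> ?s \<le> b v"
      using that by (auto simp: c_def split: if_splits)
    then show ?thesis
      using covers_right_iff[OF v n] covers_right_iff[OF v less_imp_le[OF 1(1)] 1(2)] covers_iff[OF v 1]
      by (simp add: covers_right_periodic covers_periodic)
  qed
  ultimately show ?thesis
    by (auto simp: eventually_at_right_field)
qed

lemma left_germ:
  assumes v: "v \<in> V"
  shows "\<forall>\<^sub>F s in at_left t. covers_right v s = covers_left v t"
proof -
  \<comment> \<open>Negating \<open>t\<close> turns the half-open window of representatives into one
    that contains its right end.\<close>
  obtain n0 :: int where "- a v - 2 * pi \<le> - t + 2 * pi * n0" "- t + 2 * pi * n0 < - a v - 2 * pi + 2 * pi"
    using period_representative by blast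
  then obtain n :: int where n: "a v < t + 2 * pi * n" "t + 2 * pi * n \<le> a v + 2 * pi"
    by (intro that[of "- n0"]) auto
  let ?t = "t + 2 * pi * n"
  \<comment> \<open>Going backwards, the status can change first at the start of the arc if it
    covers the angles just before \<open>t\<close>, otherwise at its end.\<close>
  define c where "c = t + (if ?t \<le> b v then a v else b v) - ?t"
  have "c < t" using n by (auto simp: c_def)
  moreover have "covers_right v s = covers_left v t" if "c < s" "s < t" for s
  proof -
    let ?s = "s + 2 * pi * n"
    have 1: "a v \<le> ?s" "?s < a v + 2 * pi"
      using n that ab[OF v] by (auto simp: c_def split: if_splits)
    have "?t \<le> b v \<longleftrightarrow> ?s < b v"
      using that by (auto simp: c_def split: if_splits)
    then show ?thesis
      using covers_left_iff[OF v n] covers_right_iff[OF v 1]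
      by (simp add: covers_right_periodic covers_left_periodic)
  qed
  ultimately show ?thesis
    by (auto simp: eventually_at_left_field)
qed

lemma start_angle:
  assumes "covers_right v t" "\<not> covers_left v t"
  obtains n :: int where "t = a v + 2 * pi * n"
proof -
  obtain n :: int where n: "a v \<le> t + 2 * pi * n" "t + 2 * pi * n < b v"
    using assms by (auto simp: covers_right_def)
  then have "a v = t + 2 * pi * n"
    using assms(2) by (metis covers_left_def less_imp_le order.order_iff_strict)
  then show thesis
    by (intro that[of "- n"]) simp
qed

lemma end_angle:
  assumes "covers_left v t" "\<not> covers_right v t"
  obtains n :: int where "t = b v + 2 * pi * n"
proof -
  obtain n :: int where n: "a v < t + 2 * pi * n" "t + 2 * pi * n \<le> b v"
    using assms by (auto simp: covers_left_def)
  then have "b v = t + 2 * pi * n"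
    using assms(2) by (metis covers_right_def less_imp_le order.order_iff_strict)
  then show thesis
    by (intro that[of "- n"]) simp
qed

lemma covers_iff_mem:
  assumes "v \<in> V"
  shows "covers v t \<longleftrightarrow> rcis (r v) t \<in> polar_arc (r v) (a v) (b v)"
proof
  assume "covers v t"
  then obtain n :: int where "a v \<le> t + 2 * pi * n" "t + 2 * pi * n \<le> b v"
    by (auto simp: covers_def)
  moreover have "rcis (r v) (t + 2 * pi * n) = rcis (r v) t"
    by (simp add: rcis_def cis_mult[symmetric] cis_multiple_2pi)
  ultimately show "rcis (r v) t \<in> polar_arc (r v) (a v) (b v)"
    unfolding polar_arc_def by (auto intro!: exI[of _ "t + 2 * pi * n"])
next
  assume "rcis (r v) t \<in> polar_arc (r v) (a v) (b v)"
  then obtain s where s: "rcis (r v) t = rcis (r v) s" "a v \<le> s" "s \<le> b v"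
    by (auto simp: polar_arc_def)
  then have "cis t = cis s"
    using r_pos[OF assms] by (simp add: rcis_def)
  then obtain n :: int where "s = t + 2 * pi * n"
    by (metis cis.sel sin_cos_eq_iff)
  then show "covers v t"
    using s by (auto simp: covers_def)
qed

text \<open>Position \<open>x > 0\<close> lies in direction \<open>t\<close>, position \<open>x < 0\<close> in direction \<open>t + pi\<close>.\<close>

definition line :: "('v \<Rightarrow> real \<Rightarrow> bool) \<Rightarrow> real \<Rightarrow> (real \<times> 'v) set" where
  "line S t = {(x, v). v \<in> V \<and> (x = r v \<and> S v t \<or> x = - r v \<and> S v (t + pi))}"

lemma finite_line: "finite (line S t)"
  by (rule finite_subset[of _ "(\<lambda>v. (r v, v)) ` V \<union> (\<lambda>v. (- r v, v)) ` V"])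
    (auto simp: line_def finite_V)

lemma line_radius: "(x, v) \<in> line S t \<Longrightarrow> \<bar>x\<bar> = r v"
  using r_pos[of v] by (auto simp: line_def)

lemma line_mem: "(x, v) \<in> line S t \<Longrightarrow> v \<in> V"
  by (simp add: line_def)

lemma pos_in_line_iff: "(r v, v) \<in> line S t \<longleftrightarrow> v \<in> V \<and> S v t"
  and neg_in_line_iff: "(- r v, v) \<in> line S t \<longleftrightarrow> v \<in> V \<and> S v (t + pi)"
  using r_pos[of v] by (auto simp: line_def)

text \<open>The sign of a position gives its direction and its absolute value the radius. Two
  objects at one position thus share a point of the plane, contrary to disjointness.\<close>

lemma single_valued_line:
  assumes S: "\<And>v t. S v t \<Longrightarrow> covers v t"
  shows "single_valued (line S t)"
proof (rule single_valuedI)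
  fix x u v assume uv: "(x, u) \<in> line S t" "(x, v) \<in> line S t"
  then have V: "u \<in> V" "v \<in> V" and r: "r u = r v"
    using line_mem line_radius by metis+
  obtain s where "covers u s" "covers v s"
    using uv S r_pos[OF V(1)] r_pos[OF V(2)] by (fastforce simp: line_def)
  then show "u = v"
    using disjoint[OF V] covers_iff_mem[OF V(1)] covers_iff_mem[OF V(2)] r by auto
qed

lemma line_periodic:
  assumes "\<And>v t m. S v (t + 2 * pi * of_int m) = S v t"
  shows "line S (t + 2 * pi * of_int m) = line S t"
proof -
  have "S v (t + 2 * pi * of_int m + pi) = S v (t + pi)" for v
    using assms[of v "t + pi" m] by (simp add: algebra_simps)
  then show ?thesis by (simp add: line_def assms)
qed

text \<open>A half turn exchanges the two directions of the line and so reverses the word.\<close>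

lemma line_mirror:
  assumes S: "\<And>v t m. S v (t + 2 * pi * of_int m) = S v t"
    and t: "t + pi = s + 2 * pi * of_int m"
  shows "line S s = mirror (line S t)"
proof -
  have "S v (t + pi) = S v s" for v
    using S[of v s m] t by simp
  moreover have "S v t = S v (s + pi)" for v
  proof -
    have "s + pi + 2 * pi * of_int m = t + 2 * pi * of_int 1"
      using t by simp
    then show ?thesis
      using S[of v t 1] S[of v "s + pi" m] by metis
  qed
  ultimately show ?thesis
    by (auto simp: line_def mirror_def)
qed

lemma line_germ:
  assumes "F \<noteq> bot" and "\<And>v. v \<in> V \<Longrightarrow> \<forall>\<^sub>F s in F. S v s = T v t"
    and "\<And>v. v \<in> V \<Longrightarrow> \<forall>\<^sub>F s in F. S v (s + pi) = T v (t + pi)"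
  shows "\<forall>\<^sub>F s in F. line S s = line T t"
proof -
  have "\<forall>\<^sub>F s in F. \<forall>v\<in>V. S v s = T v t \<and> S v (s + pi) = T v (t + pi)"
    using assms finite_V by (intro eventually_ball_finite) (auto intro: eventually_conj)
  then show ?thesis
    by eventually_elim (auto simp: line_def)
qed

lemma line_right_germ: "\<forall>\<^sub>F s in at_right t. line covers_right s = line covers_right t"
proof (rule line_germ)
  fix v assume v: "v \<in> V"
  show "\<forall>\<^sub>F s in at_right t. covers_right v s = covers_right v t"
    using right_germ[OF v, of t] by eventually_elim simp
  show "\<forall>\<^sub>F s in at_right t. covers_right v (s + pi) = covers_right v (t + pi)"
    using right_germ[OF v, of "t + pi"]
    by (subst (asm) at_right_to_0, subst at_right_to_0)
      (auto simp: eventually_filtermap add_ac elim: eventually_mono)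
qed simp

lemma line_left_germ: "\<forall>\<^sub>F s in at_left t. line covers_right s = line covers_left t"
proof (rule line_germ)
  fix v assume v: "v \<in> V"
  show "\<forall>\<^sub>F s in at_left t. covers_right v s = covers_left v t"
    by (rule left_germ[OF v])
  obtain d where "d < t + pi" "\<And>s. d < s \<Longrightarrow> s < t + pi \<Longrightarrow> covers_right v s = covers_left v (t + pi)"
    using left_germ[OF v, of "t + pi"] by (auto simp: eventually_at_left_field)
  then show "\<forall>\<^sub>F s in at_left t. covers_right v (s + pi) = covers_left v (t + pi)"
    by (auto simp: eventually_at_left_field intro!: exI[of _ "d - pi"])
qed simp

section \<open>Charging pairs to starting and ending objects\<close>

text \<open>An arbitrary numbering that fixes the order among objects ending on the same
  line.\<close>

definition rank :: "'v \<Rightarrow> nat" where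
  "rank = (SOME f. inj_on f V)"

lemma inj_on_rank: "inj_on rank V"
  unfolding rank_def using finite_imp_inj_to_nat_seg[OF finite_V] by (metis someI_ex)

text \<open>Several objects may end on the same line. They are removed one at a time: \<open>partly m\<close>
  still contains those whose rank is below \<open>m\<close>.\<close>

definition partly :: "nat \<Rightarrow> 'v \<Rightarrow> real \<Rightarrow> bool" where
  "partly m v t \<longleftrightarrow> covers_left v t \<and> (covers_right v t \<or> rank v < m)"

lemma partly_imp: "partly m v t \<Longrightarrow> covers v t"
  by (simp add: partly_def covers_left_imp)

lemma partly_periodic: "partly k v (t + 2 * pi * m) = partly k v t" for m :: int
  by (simp add: partly_def covers_left_periodic covers_right_periodic)

text \<open>The first two sets belong to the start of \<open>w\<close>, the third to its end. At
  \<open>rank w + 1\<close>, \<open>w\<close> has the highest rank among the ending objects still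
  present. The test \<open>covers_left w (b w)\<close> fails for a one-point arc, which covers no
  angles before its end.\<close>

definition charged :: "nat \<Rightarrow> 'v \<Rightarrow> 'v set set" where
  "charged k w = (\<lambda>v. {w, v}) ` {v. \<exists>q<r w. sees k (line covers_right (a w)) (r w) w q v}
     \<union> (\<lambda>v. {w, v}) ` {v. \<exists>q>r w. sees k (line covers_right (a w)) (r w) w q v}
     \<union> (if covers_left w (b w)
        then {{u, v} | u v. \<exists>p q. straddling k (line (partly (rank w + 1)) (b w)) (r w) p u q v}
        else {})"

definition outer :: "'v \<Rightarrow> nat" where
  "outer w = card {x \<in> V. r w < r x}"

lemma above_radius:
  assumes "(x, v) \<in> line S t" "r w < x" "w \<in> V"
  shows "v \<in> {x \<in> V. r w < r x}"
  using assms r_pos[of w] r_pos[of v] by (auto simp: line_def)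

text \<open>Objects seen outwards and upper ends of straddling pairs have radius above
  \<open>r w\<close>, hence the second bound \<open>outer w\<close>. Inward sightings may pass the
  origin and reach any radius; for them \<open>k + 1\<close> is used.\<close>

lemma card_charged:
  assumes w: "w \<in> V"
  shows "card (charged k w) \<le> (k + 1) + 2 * min (k + 1) (outer w)"
proof -
  let ?K = "line covers_right (a w)"
  let ?A = "{v. \<exists>q<r w. sees k ?K (r w) w q v}" and ?B = "{v. \<exists>q>r w. sees k ?K (r w) w q v}"
  let ?C = "if covers_left w (b w)
    then {{u, v} | u v. \<exists>p q. straddling k (line (partly (rank w + 1)) (b w)) (r w) p u q v}
    else {}"
  have "?A \<subseteq> V" "?B \<subseteq> V"
    by (auto simp: sees_def dest: line_mem)
  then have fin: "finite ?A" "finite ?B"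
    using finite_V finite_subset by blast+
  have K: "finite ?K" "single_valued ?K"
    by (rule finite_line) (rule single_valued_line, rule covers_right_imp)
  have A: "card ?A \<le> k + 1" and B1: "card ?B \<le> k + 1"
    by (rule card_seen_below[OF K], rule card_seen_above[OF K])
  have "?B \<subseteq> {x \<in> V. r w < r x}"
    using above_radius[OF _ _ w] unfolding sees_def by blast
  then have "card ?B \<le> outer w"
    unfolding outer_def by (rule card_mono[rotated]) (simp add: finite_V)
  with B1 have B: "card ?B \<le> min (k + 1) (outer w)" by simp
  have C: "card ?C \<le> min (k + 1) (outer w)"
  proof (cases "covers_left w (b w)")
    case True
    then have *: "(r w, w) \<in> line (partly (rank w + 1)) (b w)"
      by (simp add: pos_in_line_iff w partly_def)
    show ?thesis
      unfolding outer_def if_P[OF True]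
    proof (rule card_straddling[OF finite_line _ *])
      show "single_valued (line (partly (rank w + 1)) (b w))"
        by (rule single_valued_line) (rule partly_imp)
    qed (rule finite_subset[OF _ finite_V], blast, rule above_radius[OF _ _ w])
  qed simp
  have "card (charged k w) \<le> card ((\<lambda>v. {w, v}) ` ?A) + card ((\<lambda>v. {w, v}) ` ?B) + card ?C"
    unfolding charged_def by (intro order_trans[OF card_Un_le] add_right_mono card_Un_le)
  also have "\<dots> \<le> card ?A + card ?B + card ?C"
    by (intro add_mono card_image_le fin order_refl)
  also have "\<dots> \<le> (k + 1) + min (k + 1) (outer w) + min (k + 1) (outer w)"
    by (intro add_mono A B C)
  finally show ?thesis
    unfolding mult_2 by (simp only: add.assoc)
qed

text \<open>A sighting is always based at the object with the larger radius, which therefore does not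
  occur a second time between the two ends.\<close>

definition sighted :: "nat \<Rightarrow> 'v \<Rightarrow> 'v \<Rightarrow> (real \<times> 'v) set \<Rightarrow> bool" where
  "sighted k u v K \<longleftrightarrow> (\<exists>q. sees k K (r u) u q v)"

lemma insert_ended:
  assumes u: "u \<in> V" "v \<in> V" "u \<noteq> v" "r v \<le> r u"
    and s: "sees k (line (partly m) t) (r u) u q v"
    and no: "\<not> sighted k u v (line (partly (Suc m)) t)"
  shows "\<exists>w\<in>V. {u, v} \<in> charged k w"
proof -
  let ?K = "line (partly m) t" and ?K' = "line (partly (Suc m)) t"
  have sub: "?K \<subseteq> ?K'"
    by (auto simp: line_def partly_def)
  have "?K \<noteq> ?K'"
    using s no by (auto simp: sighted_def)
  with sub obtain x c where xc: "(x, c) \<in> ?K'" "(x, c) \<notin> ?K" by auto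
  then have c: "c \<in> V" "rank c = m"
    by (auto simp: line_def partly_def less_Suc_eq)
  \<comment> \<open>The end angle of \<open>c\<close> is unique up to whole turns, while the two
    directions differ by half a turn. So \<open>c\<close> ends in only one of them, and just one
    position is added.\<close>
  have both: False if ends: "covers_left c t" "\<not> covers_right c t" "covers_left c (t + pi)" "\<not> covers_right c (t + pi)"
  proof -
    obtain n :: int where "t = b c + 2 * pi * n"
      using ends(1,2) by (rule end_angle)
    moreover obtain n' :: int where "t + pi = b c + 2 * pi * n'"
      using ends(3,4) by (rule end_angle)
    ultimately have "pi * (1 + 2 * n) = pi * (2 * n')"
      by (simp add: algebra_simps)
    then have "1 + 2 * real_of_int n = 2 * real_of_int n'"
      using pi_neq_zero by (simp only: mult_cancel_left) simp
    then have "1 + 2 * n = 2 * n'"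
      by linarith
    then show False
      by presburger
  qed
  have ins: "?K' = insert (x, c) ?K"
  proof (intro equalityI subsetI)
    fix z assume z: "z \<in> ?K'"
    obtain y d where yd: "z = (y, d)" by fastforce
    show "z \<in> insert (x, c) ?K"
    proof (rule ccontr)
      assume "z \<notin> insert (x, c) ?K"
      then have n: "(y, d) \<in> ?K'" "(y, d) \<notin> ?K" "(y, d) \<noteq> (x, c)"
        using z yd by auto
      then have "d \<in> V" "rank d = m"
        by (auto simp: line_def partly_def less_Suc_eq)
      then have "d = c"
        using c inj_on_rank by (auto dest: inj_onD)
      then show False
        using n xc both by (auto simp: line_def partly_def)
    qed
  qed (use sub xc in auto)
  have x: "\<bar>x\<bar> = r c" using line_radius[OF xc(1)] .
  have qv: "\<bar>q\<bar> = r v" "(r u, u) \<in> ?K" "(q, v) \<in> ?K"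
    using s by (auto simp: sees_def dest: line_radius)
  have "single_valued ?K'"
    by (rule single_valued_line) (rule partly_imp)
  then have "q \<noteq> r u"
    using qv u(3) sub by (metis single_valuedD subsetD)
  then have q: "q < r u" using qv(1) u(4) by linarith
  have no': "\<not> sees k (insert (x, c) ?K) (r u) u q v" for q
    using no ins by (auto simp: sighted_def)
  \<comment> \<open>The added position would be \<open>r u\<close> or \<open>- r u\<close>; neither
    lies strictly between \<open>q\<close> and \<open>r u\<close>, because the absolute value of
    \<open>q\<close> is \<open>r v \<le> r u\<close>.\<close>
  have blocked: "c \<noteq> u"
  proof
    assume "c = u"
    have "inside ?K' (r u) q = inside ?K (r u) q"
      using x q qv(1) u(4) \<open>c = u\<close> unfolding ins inside_def by (auto simp: min_def max_def)
    then have "sees k ?K' (r u) u q v"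
      using s sub by (auto simp: sees_def)
    then show False using no by (auto simp: sighted_def)
  qed
  note ib = sees_insert_blocked[OF s no' blocked finite_line, folded ins]
  have mem: "(r u, u) \<in> ?K'" "(q, v) \<in> ?K'" using qv sub by auto
  have bet: "q < x" "x < r u" using ib(1,2) q by auto
  have ended: "covers_left c s \<and> \<not> covers_right c s"
    if "(x = r c \<and> s = t) \<or> (x = - r c \<and> s = t + pi)" for s
    using xc that r_pos[OF c(1)] by (auto simp: line_def partly_def)
  consider (same) "x = r c" | (opposite) "x = - r c" using x by linarith
  then show ?thesis
  proof cases
    case same
    then have e: "covers_left c t" "\<not> covers_right c t" using ended by auto
    then obtain n :: int where n: "t = b c + 2 * pi * n" by (rule end_angle)
    have "?K' = line (partly (rank c + 1)) (b c)"
      unfolding n by (simp add: line_periodic partly_periodic c(2))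
    moreover have "straddling k ?K' (r c) (r u) u q v"
      using bet mem ib same by (simp add: straddling_def)
    moreover have "covers_left c (b c)"
      using e(1) by (simp add: n covers_left_periodic)
    ultimately have "{u, v} \<in> charged k c"
      unfolding charged_def by auto
    then show ?thesis using c by blast
  next
    case opposite
    then have e: "covers_left c (t + pi)" "\<not> covers_right c (t + pi)" using ended by auto
    then obtain n :: int where n: "t + pi = b c + 2 * pi * n" by (rule end_angle)
    \<comment> \<open>A half turn brings \<open>c\<close> to the positive side, which makes
      \<open>v\<close> the upper end of the pair.\<close>
    have K: "line (partly (rank c + 1)) (b c) = mirror ?K'"
      using line_mirror[where S = "partly (Suc (rank c))", OF partly_periodic n] c(2) by simp
    have "straddling k (mirror ?K') (r c) (- q) v (- r u) u"
      using bet mem ib opposite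
      by (simp add: straddling_def inside_mirror inside_commute[of _ q]) (simp add: mirror_def)
    moreover have "covers_left c (b c)"
      using e(1) by (simp add: n covers_left_periodic)
    ultimately have "{v, u} \<in> charged k c"
      unfolding charged_def K by auto
    then show ?thesis using c by (auto simp: insert_commute)
  qed
qed

text \<open>A sighting that is never lost is charged at the start angle of \<open>u\<close>.
  Otherwise it appears at some \<open>t\<close>, where the word just before \<open>t\<close> lacks
  it: either one of its ends starts there, or both were present and an object ending at
  \<open>t\<close> was in the way.\<close>

lemma sighted_charged:
  assumes u: "u \<in> V" "v \<in> V" "u \<noteq> v" "r v \<le> r u" and s: "sighted k u v (line covers_right t0)"
  shows "\<exists>w\<in>V. {u, v} \<in> charged k w"
proof -
  have sv: "single_valued (line covers_right t)" for t
    by (rule single_valued_line) (rule covers_right_imp)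
  have below: "q < r u" if "sees k (line covers_right t) (r u) u q v" for q t
  proof -
    have "(r u, u) \<in> line covers_right t" "(q, v) \<in> line covers_right t"
      using that by (auto simp: sees_def)
    moreover from this have "q \<noteq> r u"
      using u(3) sv by (metis single_valuedD)
    ultimately show ?thesis
      using u(4) line_radius[of q v] by force
  qed
  show ?thesis
  proof (cases "\<forall>t. sighted k u v (line covers_right t)")
    case True
    then obtain q where "sees k (line covers_right (a u)) (r u) u q v"
      by (auto simp: sighted_def)
    then have "{u, v} \<in> charged k u"
      using below unfolding charged_def by blast
    then show ?thesis using u(1) by blast
  next
    case False
    then obtain t1 where t1: "\<not> sighted k u v (line covers_right t1)" by blast
    \<comment> \<open>Whole turns move the failing angle to before \<open>t0\<close>, as the search
      for a switch requires.\<close>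
    obtain n :: int where n: "t0 - 2 * pi \<le> t1 + 2 * pi * n" "t1 + 2 * pi * n < t0 - 2 * pi + 2 * pi"
      by (rule period_representative)
    have "\<not> sighted k u v (line covers_right (t1 + 2 * pi * n))"
      using t1 by (simp add: line_periodic covers_right_periodic)
    moreover have "t1 + 2 * pi * n < t0" using n by simp
    moreover have "\<forall>\<^sub>F s in at_right t. sighted k u v (line covers_right s) = sighted k u v (line covers_right t)" for t
      using line_right_germ[of t] by eventually_elim simp
    moreover have "\<forall>\<^sub>F s in at_left t. sighted k u v (line covers_right s) = sighted k u v (line covers_left t)" for t
      using line_left_germ[of t] by eventually_elim simp
    ultimately obtain t where t: "sighted k u v (line covers_right t)" "\<not> sighted k u v (line covers_left t)"
      using exists_switch_on[of "\<lambda>t. sighted k u v (line covers_right t)" "\<lambda>t. sighted k u v (line covers_left t)"] s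
      by blast
    then obtain q where q: "sees k (line covers_right t) (r u) u q v"
      by (auto simp: sighted_def)
    have mem: "(r u, u) \<in> line covers_right t" "(q, v) \<in> line covers_right t"
      using q by (auto simp: sees_def)
    consider "\<not> covers_left u t" | "q = r v" "\<not> covers_left v t" | "q = - r v" "\<not> covers_left v (t + pi)"
      | "(r u, u) \<in> line covers_left t" "(q, v) \<in> line covers_left t"
      using mem r_pos[OF u(1)] by (auto simp: line_def)
    then show ?thesis
    proof cases
      case 1
      then obtain n :: int where n: "t = a u + 2 * pi * n"
        using mem(1) pos_in_line_iff[of u] start_angle[of u t] by blast
      have "{u, v} \<in> charged k u"
        using q below[OF q] unfolding charged_def n by (auto simp: line_periodic covers_right_periodic)
      then show ?thesis using u(1) by blast
    next
      case 2
      then obtain n :: int where n: "t = a v + 2 * pi * n"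
        using mem(2) pos_in_line_iff[of v] start_angle[of v t] by blast
      \<comment> \<open>Here \<open>r v = q < r u\<close>, so the sighting leads outwards from
        \<open>v\<close>.\<close>
      have "{v, u} \<in> charged k v"
        using q below[OF q] 2 unfolding charged_def n sees_commute[of k _ "r u"]
        by (auto simp: line_periodic covers_right_periodic)
      then show ?thesis using u(2) by (auto simp: insert_commute)
    next
      case 3
      then obtain n :: int where n: "t + pi = a v + 2 * pi * n"
        using mem(2) neg_in_line_iff[of v] start_angle[of v "t + pi"] by blast
      \<comment> \<open>After a half turn \<open>v\<close> is at \<open>r v\<close> and
        \<open>u\<close> at \<open>- r u\<close>: the sighting leads inwards from \<open>v\<close>,
        through the origin.\<close>
      have K: "line covers_right (a v) = mirror (line covers_right t)"
        using line_mirror[OF covers_right_periodic n] .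
      have "sees k (line covers_right (a v)) (r v) v (- r u) u"
        using q 3 by (simp add: K sees_mirror sees_commute[of k _ "r u"])
      moreover have "- r u < r v"
        using r_pos[OF u(1)] r_pos[OF u(2)] by linarith
      ultimately have "{v, u} \<in> charged k v"
        unfolding charged_def by blast
      then show ?thesis using u(2) by (auto simp: insert_commute)
    next
      case 4
      let ?P = "\<lambda>m. sighted k u v (line (partly m) t)"
      \<comment> \<open>Dropping the objects that start at \<open>t\<close> only removes blockers.
        The ended ones are then put back by increasing rank until the word just before
        \<open>t\<close> is reached, so one of these insertions loses the sighting.\<close>
      have "sees k (line (partly 0) t) (r u) u q v"
        using mem 4 r_pos[OF u(1)] r_pos[OF u(2)]
        by (intro sees_subset[OF q _ _ _ finite_line]) (auto simp: line_def partly_def)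
      then have P0: "?P 0" by (auto simp: sighted_def)
      have "line (partly (Suc (Max (rank ` V)))) t = line covers_left t"
        using finite_V by (auto simp: line_def partly_def less_Suc_eq_le)
      then have "\<not> ?P (Suc (Max (rank ` V)))"
        using t by simp
      then obtain m where "?P m" "\<not> ?P (Suc m)"
        using P0 nat_induct[of ?P] by blast
      then show ?thesis
        using insert_ended[OF u] by (auto simp: sighted_def[of k u v "line (partly m) t"])
    qed
  qed
qed

section \<open>From cones to sightings\<close>

lemma arc_subset_covers:
  assumes "v \<in> V" "0 < \<rho>" "\<theta>1 < \<theta>2" "polar_arc \<rho> \<theta>1 \<theta>2 \<subseteq> polar_arc (r v) (a v) (b v)"
  shows "\<rho> = r v" "covers_right v \<theta>1"
proof -
  have mem: "rcis \<rho> t \<in> polar_arc (r v) (a v) (b v)" if "\<theta>1 \<le> t" "t \<le> \<theta>2" for t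
    using assms(4) that by (auto simp: polar_arc_def)
  obtain s where "rcis \<rho> \<theta>1 = rcis (r v) s"
    using mem[of \<theta>1] assms(3) by (auto simp: polar_arc_def)
  then have "\<bar>\<rho>\<bar> = \<bar>r v\<bar>"
    by (metis complex_mod_rcis)
  then show \<rho>: "\<rho> = r v"
    using assms(2) r_pos[OF assms(1)] by simp
  \<comment> \<open>Covering \<open>\<theta>1\<close> alone would allow the arc to end there. The
    positive width of the cone provides the angles just after it, which \<open>right_germ\<close>
    translates into \<open>covers_right\<close>.\<close>
  have "\<forall>\<^sub>F s in at_right \<theta>1. \<theta>1 < s \<and> s < \<theta>2"
    using assms(3) by (auto simp: eventually_at_right_field)
  then have "\<forall>\<^sub>F s in at_right \<theta>1. covers_right v \<theta>1"
    using right_germ[OF assms(1), of \<theta>1]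
    by eventually_elim (use mem \<rho> covers_iff_mem[OF assms(1)] in auto)
  then show "covers_right v \<theta>1"
    by simp
qed

text \<open>If \<open>v\<close> itself lies in between, then at \<open>r v\<close> with
  \<open>q = - r v\<close>, and the sighting is shortened to that position. The bound on
  \<open>q\<close> keeps \<open>u\<close> out, so only members of \<open>B\<close> are
  counted.\<close>

lemma sightedI:
  assumes u: "u \<in> V" "(r u, u) \<in> line covers_right t" and q: "(q, v) \<in> line covers_right t" "q < r u" "\<bar>q\<bar> \<le> r u"
    and B: "inside (line covers_right t) (r u) q - {u, v} \<subseteq> B" "finite B" "card B \<le> k"
  shows "sighted k u v (line covers_right t)"
proof -
  let ?K = "line covers_right t"
  have rq: "\<bar>q\<bar> = r v" using line_radius[OF q(1)] .
  have un: "u \<notin> inside ?K (r u) q"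
    using q(2,3) line_radius[of _ u] r_pos[OF u(1)] by (fastforce simp: inside_def)
  have *: "sighted k u v ?K" if "(q', v) \<in> ?K" "v \<notin> inside ?K (r u) q'" "inside ?K (r u) q' \<subseteq> inside ?K (r u) q" for q'
  proof -
    have "inside ?K (r u) q' \<subseteq> B"
      using that un B(1) by blast
    then have "card (inside ?K (r u) q') \<le> k"
      using card_mono[OF B(2)] B(3) order_trans by blast
    then show ?thesis
      using that un u(2) by (auto simp: sighted_def sees_def)
  qed
  show ?thesis
  proof (cases "v \<in> inside ?K (r u) q")
    case True
    then obtain x where x: "(x, v) \<in> ?K" "q < x" "x < r u"
      using q(2) by (auto simp: inside_def)
    then have "x = r v"
      using line_radius[OF x(1)] rq by linarith
    have "v \<notin> inside ?K (r u) x"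
      using \<open>x = r v\<close> x(3) line_radius[of _ v] by (fastforce simp: inside_def)
    moreover have "inside ?K (r u) x \<subseteq> inside ?K (r u) q"
      using x by (auto simp: inside_def)
    ultimately show ?thesis using * x(1) by blast
  qed (use * q(1) in blast)
qed

text \<open>The side of the cone at \<open>\<theta>1\<close> serves as line of sight. Any third
  object that the word just after \<open>\<theta>1\<close> has between the ends meets the cone on
  this side, so there are at most \<open>k\<close>.\<close>

lemma cone_charged:
  assumes xy: "x \<in> V" "y \<in> V" "x \<noteq> y"
    and cone: "cone C A B" and sub: "A \<subseteq> polar_arc (r x) (a x) (b x)" "B \<subseteq> polar_arc (r y) (a y) (b y)"
    and k: "card {w \<in> V - {x, y}. C \<inter> polar_arc (r w) (a w) (b w) \<noteq> {}} \<le> k"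
  shows "\<exists>w\<in>V. {x, y} \<in> charged k w"
proof -
  let ?B = "{w \<in> V - {x, y}. C \<inter> polar_arc (r w) (a w) (b w) \<noteq> {}}"
  have finB: "finite ?B" using finite_V by simp
  have blocks: "w \<in> ?B" if "w \<in> V - {x, y}" "covers_right w t" "rcis (r w) t \<in> C" for w t
    using that covers_iff_mem[of w t] covers_right_imp[of w t] by auto
  from cone show ?thesis
  proof cases
    case (radial r1 r2 \<theta>1 \<theta>2)
    have c: "r1 = r x" "covers_right x \<theta>1" "r2 = r y" "covers_right y \<theta>1"
      using arc_subset_covers[of x r1 \<theta>1 \<theta>2] arc_subset_covers[of y r2 \<theta>1 \<theta>2] radial sub xy by auto
    have "inside (line covers_right \<theta>1) (r y) (r x) - {y, x} \<subseteq> ?B"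
    proof
      fix w assume w: "w \<in> inside (line covers_right \<theta>1) (r y) (r x) - {y, x}"
      then obtain z where z: "(z, w) \<in> line covers_right \<theta>1" "r x < z" "z < r y"
        using radial c by (auto simp: inside_def)
      then have "z = r w" "w \<in> V" "covers_right w \<theta>1"
        using r_pos[of w] r_pos[OF xy(1)] by (auto simp: line_def)
      then show "w \<in> ?B"
        using w z c radial by (intro blocks[of w \<theta>1])
          (auto intro: polar_regionI)
    qed
    then have "sighted k y x (line covers_right \<theta>1)"
      using finB k c xy radial
      by (intro sightedI[where q = "r x" and B = ?B]) (auto simp: pos_in_line_iff)
    then show ?thesis
      using sighted_charged[of y x] xy c radial by (auto simp: insert_commute)
  next
    case (bow_tie r1 r2 \<theta>1 \<theta>2)
    have c: "r1 = r x" "covers_right x \<theta>1" "r2 = r y" "covers_right y (\<theta>1 + pi)"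
      using arc_subset_covers[of x r1 \<theta>1 \<theta>2] arc_subset_covers[of y r2 "\<theta>1 + pi" "\<theta>2 + pi"] bow_tie sub xy
      by auto
    have b1: "w \<in> ?B" if "w \<in> V - {x, y}" "covers_right w \<theta>1" "r w < r x" for w
      using that bow_tie c r_pos[of w] by (intro blocks[of w \<theta>1]) (auto intro: polar_regionI)
    have b2: "w \<in> ?B" if "w \<in> V - {x, y}" "covers_right w (\<theta>1 + pi)" "r w < r y" for w
      using that bow_tie c r_pos[of w]
      by (intro blocks[of w "\<theta>1 + pi"]) (auto intro: polar_regionI)
    have per: "covers_right w (\<theta>1 + pi + pi) = covers_right w \<theta>1" "covers_right w (2 * pi + \<theta>1) = covers_right w \<theta>1" for w
      using covers_right_periodic[of w \<theta>1 1] by (simp_all add: algebra_simps)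
    show ?thesis
    \<comment> \<open>The sighting must be based at the larger radius on the positive side; if that
      is \<open>y\<close>, the line is read from direction \<open>\<theta>1 + pi\<close>.\<close>
    proof (cases "r y \<le> r x")
      case True
      have "inside (line covers_right \<theta>1) (r x) (- r y) - {x, y} \<subseteq> ?B"
      proof
        fix w assume w: "w \<in> inside (line covers_right \<theta>1) (r x) (- r y) - {x, y}"
        then obtain z where z: "(z, w) \<in> line covers_right \<theta>1" "- r y < z" "z < r x"
          using r_pos[OF xy(1)] r_pos[OF xy(2)] by (auto simp: inside_def)
        then show "w \<in> ?B"
          using w b1[of w] b2[of w] by (auto simp: line_def)
      qed
      then have "sighted k x y (line covers_right \<theta>1)"
        using finB k c xy True r_pos[of x] r_pos[of y]
        by (intro sightedI[where q = "- r y" and B = ?B]) (auto simp: pos_in_line_iff neg_in_line_iff)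
      then show ?thesis
        using sighted_charged[of x y] xy True by auto
    next
      case False
      have "inside (line covers_right (\<theta>1 + pi)) (r y) (- r x) - {y, x} \<subseteq> ?B"
      proof
        fix w assume w: "w \<in> inside (line covers_right (\<theta>1 + pi)) (r y) (- r x) - {y, x}"
        then obtain z where z: "(z, w) \<in> line covers_right (\<theta>1 + pi)" "- r x < z" "z < r y"
          using r_pos[OF xy(1)] r_pos[OF xy(2)] by (auto simp: inside_def)
        then show "w \<in> ?B"
          using w b1[of w] b2[of w] by (auto simp: line_def per)
      qed
      then have "sighted k y x (line covers_right (\<theta>1 + pi))"
        using finB k c xy False r_pos[of x] r_pos[of y]
        by (intro sightedI[where q = "- r x" and B = ?B]) (auto simp: pos_in_line_iff neg_in_line_iff per)
      then show ?thesis
        using sighted_charged[of y x] xy False by (auto simp: insert_commute)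
    qed
  qed
qed

lemma charged_subset: "w \<in> V \<Longrightarrow> charged k w \<subseteq> Pow V"
  unfolding charged_def sees_def straddling_def using line_mem by (fastforce split: if_splits)

lemma card_edges:
  assumes "k_visibility_representation k V E (\<lambda>v. polar_arc (r v) (a v) (b v))" and "simple_graph V E"
  shows "card E \<le> (\<Sum>w\<in>V. (k + 1) + 2 * min (k + 1) (outer w))"
proof -
  have "E \<subseteq> (\<Union>w\<in>V. charged k w)"
  proof
    fix e assume e: "e \<in> E"
    then have "e \<subseteq> V" "card e = 2"
      using assms(2) by (auto simp: simple_graph_def)
    then obtain u v where uv: "e = {u, v}" "u \<noteq> v" "u \<in> V" "v \<in> V"
      by (metis card_2_iff insert_subset)
    then have "k_visible k V (\<lambda>v. polar_arc (r v) (a v) (b v)) u v"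
      using assms(1) e by (auto simp: k_visibility_representation_def)
    then have "\<exists>w\<in>V. {u, v} \<in> charged k w"
      unfolding k_visible_def
    proof (elim exE conjE disjE)
      fix C A B
      assume "cone C A B" "card {w \<in> V - {u, v}. C \<inter> polar_arc (r w) (a w) (b w) \<noteq> {}} \<le> k"
        "A \<subseteq> polar_arc (r u) (a u) (b u)" "B \<subseteq> polar_arc (r v) (a v) (b v)"
      then show ?thesis
        using uv by (intro cone_charged)
    next
      fix C A B
      assume "cone C A B" "card {w \<in> V - {u, v}. C \<inter> polar_arc (r w) (a w) (b w) \<noteq> {}} \<le> k"
        "A \<subseteq> polar_arc (r v) (a v) (b v)" "B \<subseteq> polar_arc (r u) (a u) (b u)"
      then have "\<exists>w\<in>V. {v, u} \<in> charged k w"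
        using uv by (intro cone_charged[of v u C A B]) (simp_all add: insert_commute)
      then show ?thesis
        by (simp add: insert_commute)
    qed
    then show "e \<in> (\<Union>w\<in>V. charged k w)" using uv by simp
  qed
  moreover have "finite (\<Union>w\<in>V. charged k w)"
    by (rule finite_UN_I[OF finite_V], rule finite_subset[OF charged_subset]) (auto simp: finite_V)
  ultimately have "card E \<le> card (\<Union>w\<in>V. charged k w)"
    by (simp add: card_mono)
  also have "\<dots> \<le> (\<Sum>w\<in>V. card (charged k w))"
    by (rule card_UN_le[OF finite_V])
  also have "\<dots> \<le> (\<Sum>w\<in>V. (k + 1) + 2 * min (k + 1) (outer w))"
    by (intro sum_mono card_charged)
  finally show ?thesis .
qed

end

section \<open>Summation and the final bound\<close>

text \<open>Objects are added from outside inwards. A new one of least radius changes no earlier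
  count, and its own count is at most the number of objects already present.\<close>

lemma sum_min_card_above:
  fixes r :: "'v \<Rightarrow> real"
  assumes "finite V"
  shows "(\<Sum>w\<in>V. min m (card {x \<in> V. r w < r x})) \<le> (\<Sum>j<card V. min m j)"
  using assms
proof (induction V rule: finite_ranking_induct[where f = "\<lambda>v. - r v"])
  case (insert x S)
  show ?case
  proof (cases "x \<in> S")
    case True
    then show ?thesis
      using insert.IH by (simp only: insert_absorb)
  next
    case False
    have 1: "{y \<in> insert x S. r w < r y} = {y \<in> S. r w < r y}" if "w \<in> insert x S" for w
    proof -
      have "r x \<le> r w"
        using insert that by auto
      then show ?thesis by auto
    qed
    have "(\<Sum>w\<in>insert x S. min m (card {y \<in> insert x S. r w < r y}))
        = (\<Sum>w\<in>insert x S. min m (card {y \<in> S. r w < r y}))"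
      by (rule sum.cong) (simp_all only: 1)
    also have "\<dots> = min m (card {y \<in> S. r x < r y}) + (\<Sum>w\<in>S. min m (card {y \<in> S. r w < r y}))"
      using insert False by simp
    also have "\<dots> \<le> min m (card S) + (\<Sum>j<card S. min m j)"
    proof (rule add_mono)
      show "min m (card {y \<in> S. r x < r y}) \<le> min m (card S)"
        using card_mono[OF insert(1), of "{y \<in> S. r x < r y}"] by auto
    qed (rule insert.IH)
    also have "\<dots> = (\<Sum>j<card (insert x S). min m j)"
      using insert False by simp
    finally show ?thesis .
  qed
qed simp

text \<open>The terms are \<open>j\<close> below \<open>m\<close> and \<open>m\<close> from there
  on. Doubling avoids a division, and integers avoid truncated subtraction.\<close>

lemma sum_min_lessThan:
  assumes "m \<le> n"
  shows "2 * int (\<Sum>j<n. min m j) = 2 * int m * int n - int m * (int m + 1)"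
  using assms
proof (induction n rule: dec_induct)
  case base
  have "(\<Sum>j<m. min m j) = (\<Sum>j<m. j)"
    by (rule sum.cong) auto
  moreover have "2 * int (\<Sum>j<m. j) = int m * (int m - 1)"
    by (induction m) (auto simp: algebra_simps)
  ultimately show ?case by (simp add: algebra_simps)
next
  case (step n)
  then show ?case by (simp add: algebra_simps)
qed

lemma sphere_eq_polar_arc:
  assumes "0 < \<rho>"
  shows "sphere 0 \<rho> = polar_arc \<rho> 0 (2 * pi)"
proof (intro equalityI subsetI)
  fix z :: complex assume "z \<in> sphere 0 \<rho>"
  then have "z = rcis \<rho> (Arg2pi z)"
    using Arg2pi_eq[of z] by (simp add: rcis_def cis_conv_exp)
  then show "z \<in> polar_arc \<rho> 0 (2 * pi)"
    unfolding polar_arc_def using Arg2pi_ge_0[of z] Arg2pi_lt_2pi[of z]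
    by (intro CollectI exI[of _ "Arg2pi z"] conjI) simp_all
qed (use assms in \<open>auto simp: polar_arc_def\<close>)

lemma arc_or_circle_polar:
  assumes "is_arc S \<or> is_circle S"
  obtains \<rho> \<alpha> \<beta> where "0 < \<rho>" "\<alpha> \<le> \<beta>" "\<beta> \<le> \<alpha> + 2 * pi" "S = polar_arc \<rho> \<alpha> \<beta>"
  using assms
proof
  assume "is_arc S"
  then obtain \<rho> \<alpha> \<beta> where "0 < \<rho>" "0 \<le> \<beta> - \<alpha>" "\<beta> - \<alpha> < 2 * pi" "S = polar_arc \<rho> \<alpha> \<beta>"
    unfolding is_arc_def by blast
  then show thesis
    by (intro that[of \<rho> \<alpha> \<beta>]) simp_all
next
  assume "is_circle S"
  then obtain \<rho> where "0 < \<rho>" "S = sphere 0 \<rho>"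
    unfolding is_circle_def by blast
  then show thesis
    using sphere_eq_polar_arc[of \<rho>] by (intro that[of \<rho> 0 "2 * pi"]) simp_all
qed

theorem theorem10:
  fixes k n :: nat and V :: "'v set" and E :: "'v set set"
  assumes "circle_k_visibility_graph k V E \<or> arc_k_visibility_graph k V E"
    and "card V = n"
  shows "(n > 4 * k + 4 \<longrightarrow> int (card E) \<le> (int k + 1) * (3 * int n - int k - 2))
    \<and> (n \<le> 4 * k + 4 \<longrightarrow> card E \<le> n choose 2)"
proof (intro conjI impI)
  have G: "simple_graph V E"
    using assms(1) by (auto simp: circle_k_visibility_graph_def arc_k_visibility_graph_def)
  then have V: "finite V" and E: "E \<subseteq> {e. e \<subseteq> V \<and> card e = 2}"
    by (auto simp: simple_graph_def)
  show "card E \<le> n choose 2"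
    using card_mono[OF _ E] n_subsets[OF V, of 2] V assms(2) by simp
  assume n: "n > 4 * k + 4"
  obtain f where f: "\<And>v. v \<in> V \<Longrightarrow> is_arc (f v) \<or> is_circle (f v)" "k_visibility_representation k V E f"
    using assms(1) unfolding circle_k_visibility_graph_def arc_k_visibility_graph_def by blast
  have "\<forall>v\<in>V. \<exists>\<rho> \<alpha> \<beta>. 0 < \<rho> \<and> \<alpha> \<le> \<beta> \<and> \<beta> \<le> \<alpha> + 2 * pi \<and> f v = polar_arc \<rho> \<alpha> \<beta>"
  proof
    fix v assume "v \<in> V"
    then have "is_arc (f v) \<or> is_circle (f v)"
      by (rule f(1))
    then show "\<exists>\<rho> \<alpha> \<beta>. 0 < \<rho> \<and> \<alpha> \<le> \<beta> \<and> \<beta> \<le> \<alpha> + 2 * pi \<and> f v = polar_arc \<rho> \<alpha> \<beta>"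
      by (rule arc_or_circle_polar) blast
  qed
  then obtain r a b where p: "\<And>v. v \<in> V \<Longrightarrow> 0 < r v \<and> a v \<le> b v \<and> b v \<le> a v + 2 * pi \<and> f v = polar_arc (r v) (a v) (b v)"
    unfolding bchoice_iff by blast
  interpret arcs V r a b
  proof
    fix u v assume "u \<in> V" "v \<in> V" "polar_arc (r u) (a u) (b u) \<inter> polar_arc (r v) (a v) (b v) \<noteq> {}"
    then have "f u \<inter> f v \<noteq> {}" "u \<in> V" "v \<in> V"
      using p by simp_all
    then show "u = v"
      using f(2) disjoint_family_onD unfolding k_visibility_representation_def by metis
  qed (use V p in auto)
  \<comment> \<open>Only objects in \<open>V\<close> act as ends and blockers, and there
    \<open>f\<close> agrees with its polar description.\<close>
  have "k_visible k V (\<lambda>v. polar_arc (r v) (a v) (b v)) u v = k_visible k V f u v" if "u \<in> V" "v \<in> V" for u v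
  proof -
    have "{w \<in> V - {u, v}. C \<inter> polar_arc (r w) (a w) (b w) \<noteq> {}} = {w \<in> V - {u, v}. C \<inter> f w \<noteq> {}}" for C
      using p by auto
    then show ?thesis
      using that p by (simp add: k_visible_def)
  qed
  then have "k_visibility_representation k V E (\<lambda>v. polar_arc (r v) (a v) (b v))"
    using f(2) p by (simp add: k_visibility_representation_def disjoint_family_on_def)
  then have "card E \<le> (\<Sum>w\<in>V. (k + 1) + 2 * min (k + 1) (outer w))"
    using G by (rule card_edges)
  also have "\<dots> = n * (k + 1) + 2 * (\<Sum>w\<in>V. min (k + 1) (outer w))"
    by (subst sum.distrib) (simp add: sum_distrib_left assms(2))
  also have "\<dots> \<le> n * (k + 1) + 2 * (\<Sum>j<n. min (k + 1) j)"
    using sum_min_card_above[OF V, of "k + 1" r] assms(2) by (simp add: outer_def)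
  finally have "int (card E) \<le> int (n * (k + 1) + 2 * (\<Sum>j<n. min (k + 1) j))"
    by (simp only: of_nat_le_iff)
  also have "\<dots> = int n * (int k + 1) + 2 * int (\<Sum>j<n. min (k + 1) j)"
    by (simp only: of_nat_add of_nat_mult of_nat_1 of_nat_numeral)
  \<comment> \<open>With \<open>m = k + 1\<close> the doubled sum is
    \<open>2 * (k + 1) * n - (k + 1) * (k + 2)\<close>; the required \<open>k + 1 \<le> n\<close>
    follows from \<open>n > 4 * k + 4\<close>.\<close>
  also have "\<dots> = (int k + 1) * (3 * int n - int k - 2)"
    using sum_min_lessThan[of "k + 1" n] n by (simp add: algebra_simps)
  finally show "int (card E) \<le> (int k + 1) * (3 * int n - int k - 2)" .
qed

end
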